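(* There is a sequence $(a_N)$ such that for arbitrary $m\in\mathbb{N}$ and arbitrary subset $A\subset V_m$, given any two (distinct) points $x,y\in A$ with $d(x,y)=N$, one has $$a_N\left(\tfrac53\right)^m\le c^A_{x,y},$$ where $d(x,y)$ denotes the length (number of edges) of a shortest path in $V_m$ from $x$ to $y$ that does not intersect any other points of $A$ (i.e. any point of $A$ other than $x$ and $y$).
   Context: Let $q_0,q_1,q_2$ be the vertices of an equilateral triangle in the plane, $F_i(x)=\frac12(x+q_i)$, and let $SG$ (the Sierpinski gasket) be the unique nonempty compact set with $SG=\bigcup_{i}F_i(SG)$. For a word $w=w_1\cdots w_m$ let $F_w=F_{w_1}\circ\cdots\circ F_{w_m}$. Put $V_0=\{q_0,q_1,q_2\}$, $V_m=\bigcup_iF_iV_{m-1}$; $x\sim_m y$ means $x\ne y$ and $x,y\in F_wV_0$ for some word $w$ of length $m$. $V_m$ is regarded as a graph with edge relation $\sim_m$. The energy of a continuous $u:SG\to\mathbb{R}$ is $\mathcal{E}(u)=\lim_{m\to\infty}\left(\frac53\right)^m\sum_{\{x,y\}:x\sim_m y}(u(x)-u(y))^2$ (a nondecreasing limit), and $\operatorname{dom}\mathcal{E}$ is the set of continuous $u$ with $\mathcal{E}(u)<\infty$. For a nonempty set $A\subset V_m$ and values prescribed on $A$, there is a unique $u\in\operatorname{dom}\mathcal{E}$ of least energy with these values on $A$, and its energy has the form $\mathcal{E}(u)=\sum_{\{x,y\}\subset A}c^A_{x,y}(u(x)-u(y))^2$; the (uniquely determined, symmetric) coefficients $c^A_{x,y}$,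 $x\neq y$, are the conductances of $A$. *)

theory Defs
  imports "HOL-Analysis.Analysis" "HOL-Library.Extended_Real" "HOL-Library.Extended_Nat"
begin

definition equilateral :: "(3 \<Rightarrow> real ^ 2) \<Rightarrow> bool" where
  "equilateral q \<longleftrightarrow> (\<exists>s>0. \<forall>i j. i \<noteq> j \<longrightarrow> dist (q i) (q j) = s)"

definition sg_map :: "(3 \<Rightarrow> real ^ 2) \<Rightarrow> 3 \<Rightarrow> real ^ 2 \<Rightarrow> real ^ 2" where
  "sg_map q i x = (1 / 2) *\<^sub>R (x + q i)"

definition SG :: "(3 \<Rightarrow> real ^ 2) \<Rightarrow> (real ^ 2) set" where
  "SG q = (THE K. K \<noteq> {} \<and> compact K \<and> K = (\<Union>i. sg_map q i ` K))"

fun word_map :: "(3 \<Rightarrow> real ^ 2) \<Rightarrow> 3 list \<Rightarrow> real ^ 2 \<Rightarrow> real ^ 2" where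
  "word_map q [] = id"
| "word_map q (i # w) = sg_map q i \<circ> word_map q w"

fun vertices :: "(3 \<Rightarrow> real ^ 2) \<Rightarrow> nat \<Rightarrow> (real ^ 2) set" where
  "vertices q 0 = range q"
| "vertices q (Suc m) = (\<Union>i. sg_map q i ` vertices q m)"

definition adj :: "(3 \<Rightarrow> real ^ 2) \<Rightarrow> nat \<Rightarrow> real ^ 2 \<Rightarrow> real ^ 2 \<Rightarrow> bool" where
  "adj q m x y \<longleftrightarrow> x \<noteq> y \<and>
     (\<exists>w. length w = m \<and> x \<in> word_map q w ` vertices q 0 \<and> y \<in> word_map q w ` vertices q 0)"

text \<open>
  The sum over unordered edges is half the sum over ordered pairs.
\<close>

definition level_energy :: "(3 \<Rightarrow> real ^ 2) \<Rightarrow> nat \<Rightarrow> (real ^ 2 \<Rightarrow> real) \<Rightarrow> real" where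
  "level_energy q m u =
     (5 / 3) ^ m * ((\<Sum>x\<in>vertices q m. \<Sum>y | y \<in> vertices q m \<and> adj q m x y. (u x - u y)\<^sup>2) / 2)"

text \<open>
  Functions on the gasket are represented by total functions on the plane, of which only the
  restriction to the gasket matters. The limit is taken in the extended reals, so that infinite
  energy is allowed.
\<close>

definition energy :: "(3 \<Rightarrow> real ^ 2) \<Rightarrow> (real ^ 2 \<Rightarrow> real) \<Rightarrow> ereal" where
  "energy q u = lim (\<lambda>m. ereal (level_energy q m u))"

definition energy_dom :: "(3 \<Rightarrow> real ^ 2) \<Rightarrow> (real ^ 2 \<Rightarrow> real) set" where
  "energy_dom q = {u. continuous_on (SG q) u \<and> energy q u < \<infinity>}"

definition energy_minimizer ::
  "(3 \<Rightarrow> real ^ 2) \<Rightarrow> (real ^ 2) set \<Rightarrow> (real ^ 2 \<Rightarrow> real) \<Rightarrow> (real ^ 2 \<Rightarrow> real) \<Rightarrow> bool" where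
  "energy_minimizer q A f u \<longleftrightarrow>
     u \<in> energy_dom q \<and> (\<forall>x\<in>A. u x = f x) \<and>
     (\<forall>v\<in>energy_dom q. (\<forall>x\<in>A. v x = f x) \<longrightarrow> energy q u \<le> energy q v)"

text \<open>
  The conductances are determined only at pairs of distinct points of \<open>A\<close>; they are set to zero at
  all other pairs, so that the description below is definite. The sum over unordered pairs is
  again half the sum over ordered pairs.
\<close>

definition is_conductance ::
  "(3 \<Rightarrow> real ^ 2) \<Rightarrow> (real ^ 2) set \<Rightarrow> (real ^ 2 \<Rightarrow> real ^ 2 \<Rightarrow> real) \<Rightarrow> bool" where
  "is_conductance q A c \<longleftrightarrow>
     (\<forall>x y. c x y = c y x) \<and>
     (\<forall>x y. x \<notin> A \<or> y \<notin> A \<or> x = y \<longrightarrow> c x y = 0) \<and>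
     (\<forall>f u. energy_minimizer q A f u \<longrightarrow>
        energy q u = ereal ((\<Sum>x\<in>A. \<Sum>y\<in>A. c x y * (u x - u y)\<^sup>2) / 2))"

definition conductance ::
  "(3 \<Rightarrow> real ^ 2) \<Rightarrow> (real ^ 2) set \<Rightarrow> real ^ 2 \<Rightarrow> real ^ 2 \<Rightarrow> real" where
  "conductance q A = (THE c. is_conductance q A c)"

definition avoiding_path ::
  "(3 \<Rightarrow> real ^ 2) \<Rightarrow> nat \<Rightarrow> (real ^ 2) set \<Rightarrow> real ^ 2 \<Rightarrow> real ^ 2 \<Rightarrow> (real ^ 2) list \<Rightarrow> bool" where
  "avoiding_path q m A x y p \<longleftrightarrow>
     p \<noteq> [] \<and> hd p = x \<and> last p = y \<and> set p \<subseteq> vertices q m \<and>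
     successively (adj q m) p \<and> set p \<inter> A \<subseteq> {x, y}"

text \<open>
  A path is the list of its vertices, so it has one edge fewer than its list length. The distance
  is \<open>\<infinity>\<close> if there is no such path.
\<close>

definition avoiding_dist ::
  "(3 \<Rightarrow> real ^ 2) \<Rightarrow> nat \<Rightarrow> (real ^ 2) set \<Rightarrow> real ^ 2 \<Rightarrow> real ^ 2 \<Rightarrow> enat" where
  "avoiding_dist q m A x y = (INF p\<in>{p. avoiding_path q m A x y p}. enat (length p - 1))"

end

theory Submission
  imports Defs
begin

text \<open>
  The energy of a function of least energy among those with given values on \<open>V\<^sub>m\<close> is its level-\<open>m\<close>
  graph energy, so the conductances of \<open>A \<subseteq> V\<^sub>m\<close> are those of the trace on \<open>A\<close> of a finite network
  with edge conductances \<open>(5/3)\<^sup>m\<close> and bounded degrees. The trace arises by removing the vertices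
  outside \<open>A\<close> one at a time with the star-mesh transform, which adds \<open>c\<^sub>x\<^sub>v c\<^sub>v\<^sub>y / \<Sum>\<^sub>z c\<^sub>v\<^sub>z\<close> to
  \<open>c\<^sub>x\<^sub>y\<close>. This never increases the total conductance at a vertex, hence with \<open>M\<close> a bound on these
  totals, the product of \<open>c/M\<close> along a simple path does not drop when a vertex is removed from
  both the path and the network. In the end the path from \<open>x\<close> to \<open>y\<close> has become a single edge.
\<close>

subsection \<open>Finite resistor networks\<close>

definition network :: "'a set \<Rightarrow> ('a \<Rightarrow> 'a \<Rightarrow> real) \<Rightarrow> bool" where
  "network V c \<longleftrightarrow> finite V \<and> (\<forall>x y. c x y = c y x) \<and> (\<forall>x y. 0 \<le> c x y) \<and>
     (\<forall>x y. x \<notin> V \<or> y \<notin> V \<or> x = y \<longrightarrow> c x y = 0)"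

definition dirichlet :: "'a set \<Rightarrow> ('a \<Rightarrow> 'a \<Rightarrow> real) \<Rightarrow> ('a \<Rightarrow> real) \<Rightarrow> real" where
  "dirichlet V c u = (\<Sum>x\<in>V. \<Sum>y\<in>V. c x y * (u x - u y)\<^sup>2) / 2"

text \<open>At an isolated \<open>v\<close> the quotient is \<open>0 / 0 = 0\<close>, so removing it changes nothing, as it should.\<close>

definition eliminate :: "'a set \<Rightarrow> 'a \<Rightarrow> ('a \<Rightarrow> 'a \<Rightarrow> real) \<Rightarrow> 'a \<Rightarrow> 'a \<Rightarrow> real" where
  "eliminate V v c x y =
     (if x = v \<or> y = v \<or> x = y then 0 else c x y + c x v * c v y / (\<Sum>z\<in>V. c v z))"

text \<open>Dividing every edge by \<open>M\<close> is what lets the weight survive an elimination: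
  merging two edges costs one division by the row sum at the removed vertex, which is at most
  \<open>M\<close>.\<close>

fun path_weight :: "('a \<Rightarrow> 'a \<Rightarrow> real) \<Rightarrow> real \<Rightarrow> 'a list \<Rightarrow> real" where
  "path_weight c M (x # y # p) = c x y / M * path_weight c M (y # p)"
| "path_weight c M p = 1"

section \<open>Energy and row sums under the star-mesh transform\<close>

lemma dirichlet_cong: "(\<And>x. x \<in> V \<Longrightarrow> u x = w x) \<Longrightarrow> dirichlet V c u = dirichlet V c w"
  by (simp add: dirichlet_def)

text \<open>Completing the square in \<open>t\<close>: the minimum is at the weighted mean, and the
  remainder is the weighted variance written through pairwise differences. Its coefficients are
  those of the star-mesh transform.\<close>

lemma weighted_variance:
  fixes c u :: "'a \<Rightarrow> real"
  assumes "(\<Sum>x\<in>V. c x) \<noteq> 0"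
  shows "(\<Sum>x\<in>V. c x * (t - u x)\<^sup>2) =
    (\<Sum>x\<in>V. c x) * (t - (\<Sum>x\<in>V. c x * u x) / (\<Sum>x\<in>V. c x))\<^sup>2 +
    (\<Sum>x\<in>V. \<Sum>y\<in>V. c x * c y / (\<Sum>x\<in>V. c x) * (u x - u y)\<^sup>2) / 2"
proof -
  define C S T where "C = (\<Sum>x\<in>V. c x)" and "S = (\<Sum>x\<in>V. c x * u x)"
    and "T = (\<Sum>x\<in>V. c x * (u x)\<^sup>2)"
  have C: "C \<noteq> 0" using assms by (simp add: C_def)
  have 1: "(\<Sum>x\<in>V. c x * (t - u x)\<^sup>2) = C * t\<^sup>2 - 2 * t * S + T"
    by (simp add: C_def S_def T_def power2_eq_square algebra_simps sum.distrib sum_subtractf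
        sum_distrib_left)
  have "(\<Sum>x\<in>V. \<Sum>y\<in>V. c x * c y * (u x - u y)\<^sup>2)
      = (\<Sum>x\<in>V. \<Sum>y\<in>V. (c x * (u x)\<^sup>2) * c y - 2 * ((c x * u x) * (c y * u y)) + c x * (c y * (u y)\<^sup>2))"
    by (intro sum.cong refl) (simp add: power2_eq_square algebra_simps)
  also have "\<dots> = T * C - 2 * (S * S) + C * T"
    by (simp add: C_def S_def T_def sum.distrib sum_subtractf sum_product
        flip: sum_distrib_left)
  finally have "(\<Sum>x\<in>V. \<Sum>y\<in>V. c x * c y * (u x - u y)\<^sup>2) = 2 * (C * T - S\<^sup>2)"
    by (simp add: power2_eq_square)
  moreover have "(\<Sum>x\<in>V. \<Sum>y\<in>V. c x * c y / C * (u x - u y)\<^sup>2)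
      = (\<Sum>x\<in>V. \<Sum>y\<in>V. c x * c y * (u x - u y)\<^sup>2) / C"
    by (simp add: sum_divide_distrib)
  ultimately have 2: "(\<Sum>x\<in>V. \<Sum>y\<in>V. c x * c y / C * (u x - u y)\<^sup>2) = 2 * (C * T - S\<^sup>2) / C"
    by simp
  have "C * t\<^sup>2 - 2 * t * S + T = C * (t - S / C)\<^sup>2 + 2 * (C * T - S\<^sup>2) / C / 2"
    using C by (simp add: field_simps power2_eq_square)
  then show ?thesis
    using 1 2 by (simp add: C_def S_def)
qed

text \<open>Nonnegative terms with sum zero vanish; this settles the cases in which a quotient by
  the row sum degenerates to division by zero.\<close>

lemma network_row_sum_zero:
  assumes "network V c" "(\<Sum>y\<in>V. c v y) = 0"
  shows "c v y = 0"
proof (cases "y \<in> V")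
  case True
  moreover have "\<forall>y\<in>V. c v y = 0"
    using assms sum_nonneg_eq_0_iff[of V "c v"] by (simp add: network_def)
  ultimately show ?thesis by simp
qed (use assms in \<open>auto simp: network_def\<close>)

lemma dirichlet_insert:
  assumes "network (insert v W) c" "v \<notin> W"
  shows "dirichlet (insert v W) c u = dirichlet W c u + (\<Sum>y\<in>W. c v y * (u v - u y)\<^sup>2)"
proof -
  have fin: "finite W" and sym: "\<And>x. c x v = c v x" using assms(1) by (auto simp: network_def)
  \<comment> \<open>Each edge at \<open>v\<close> occurs in both orders, which absorbs the factor
    1/2.\<close>
  have "(\<Sum>y\<in>W. c y v * (u y - u v)\<^sup>2) = (\<Sum>y\<in>W. c v y * (u v - u y)\<^sup>2)"
    by (intro sum.cong refl) (subst sym, subst power2_commute, rule refl)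
  then show ?thesis
    using assms(2) fin by (simp add: dirichlet_def sum.distrib)
qed

text \<open>This is \<open>weighted_variance\<close> with \<open>t = u v\<close>. The remaining
  square is nonnegative and vanishes when \<open>u v\<close> is the weighted mean of its neighbours,
  so elimination amounts to minimizing over \<open>u v\<close>.\<close>

lemma dirichlet_eliminate:
  assumes net: "network (insert v W) c" and v: "v \<notin> W"
  defines "C \<equiv> \<Sum>z\<in>insert v W. c v z"
  shows "dirichlet (insert v W) c u =
    dirichlet W (eliminate (insert v W) v c) u + C * (u v - (\<Sum>x\<in>W. c v x * u x) / C)\<^sup>2"
proof -
  have fin: "finite W" and sym: "\<And>x y. c x y = c y x" and vv: "c v v = 0"
    using net by (auto simp: network_def)
  have CW: "C = (\<Sum>z\<in>W. c v z)" using fin v vv by (simp add: C_def)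
  have "dirichlet W (eliminate (insert v W) v c) u =
      (\<Sum>x\<in>W. \<Sum>y\<in>W. c x y * (u x - u y)\<^sup>2 + c v x * c v y / C * (u x - u y)\<^sup>2) / 2"
    unfolding dirichlet_def C_def
  proof (intro arg_cong2[where f="(/)"] sum.cong refl)
    fix x y assume "x \<in> W" "y \<in> W"
    then show "eliminate (insert v W) v c x y * (u x - u y)\<^sup>2 =
        c x y * (u x - u y)\<^sup>2 + c v x * c v y / (\<Sum>z\<in>insert v W. c v z) * (u x - u y)\<^sup>2"
      using v sym[of x v] by (auto simp: eliminate_def distrib_right)
  qed
  also have "\<dots> = dirichlet W c u + (\<Sum>x\<in>W. \<Sum>y\<in>W. c v x * c v y / C * (u x - u y)\<^sup>2) / 2"
    by (simp add: dirichlet_def sum.distrib add_divide_distrib)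
  finally have el: "dirichlet W (eliminate (insert v W) v c) u =
    dirichlet W c u + (\<Sum>x\<in>W. \<Sum>y\<in>W. c v x * c v y / C * (u x - u y)\<^sup>2) / 2" .
  show ?thesis
  proof (cases "C = 0")
    case True
    then have "c v y = 0" for y
      using network_row_sum_zero[OF net] by (simp add: C_def)
    then show ?thesis
      using True el dirichlet_insert[OF net v] by simp
  next
    case False
    then show ?thesis
      using weighted_variance[where V=W and c="c v" and t="u v" and u=u] el dirichlet_insert[OF net v] by (simp add: CW)
  qed
qed

lemma network_eliminate:
  assumes net: "network (insert v W) c"
  shows "network W (eliminate (insert v W) v c)"
  using net by (auto simp: network_def eliminate_def intro!: sum_nonneg add_nonneg_nonneg divide_nonneg_nonneg)

lemma eliminate_ge:
  assumes net: "network (insert v W) c" and "x \<noteq> v" "y \<noteq> v"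
  shows "c x y \<le> eliminate (insert v W) v c x y"
  using assms by (auto simp: network_def eliminate_def intro!: divide_nonneg_nonneg sum_nonneg)

text \<open>The lost conductance \<open>c x v\<close> is redistributed among the neighbours of
  \<open>v\<close> in the proportions \<open>c v y / C\<close>. The share that would return to
  \<open>x\<close> itself is discarded, hence only an inequality.\<close>

lemma row_sum_eliminate_le:
  assumes net: "network (insert v W) c" and v: "v \<notin> W" and x: "x \<in> W"
  shows "(\<Sum>y\<in>W. eliminate (insert v W) v c x y) \<le> (\<Sum>y\<in>insert v W. c x y)"
proof -
  have fin: "finite W" and sym: "\<And>x y. c x y = c y x" and vv: "c v v = 0" and nn: "\<And>x y. 0 \<le> c x y"
    using net by (auto simp: network_def)
  define C where "C = (\<Sum>z\<in>insert v W. c v z)"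
  have CW: "C = (\<Sum>z\<in>W. c v z)" using fin v vv by (simp add: C_def)
  have C0: "C \<ge> 0" by (simp add: C_def sum_nonneg nn)
  have "(\<Sum>y\<in>W. eliminate (insert v W) v c x y) \<le> (\<Sum>y\<in>W. c x y + c x v * c v y / C)"
    using v x nn C0 by (intro sum_mono) (auto simp: eliminate_def C_def)
  also have "\<dots> = (\<Sum>y\<in>W. c x y) + c x v * C / C"
    by (simp add: sum.distrib CW sum_distrib_left sum_divide_distrib)
  also have "\<dots> \<le> (\<Sum>y\<in>W. c x y) + c x v"
    using nn by (cases "C = 0") auto
  also have "\<dots> = (\<Sum>y\<in>insert v W. c x y)"
    using fin v by simp
  finally show ?thesis .
qed

section \<open>Weights of paths and the trace of a network\<close>

lemma path_weight_nonneg: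
  "(\<And>x y. 0 \<le> c x y) \<Longrightarrow> 0 < M \<Longrightarrow> 0 \<le> path_weight c M p"
  by (induction c M p rule: path_weight.induct) auto

lemma path_weight_append:
  "path_weight c M (p @ x # r) = path_weight c M (p @ [x]) * path_weight c M (x # r)"
proof (induction p)
  case (Cons a p)
  then show ?case by (cases p) auto
qed simp

text \<open>The comparison is local to the vertices of \<open>p\<close> because
  \<open>eliminate\<close> sets the entries at the removed vertex to zero and raises only the
  others.\<close>

lemma path_weight_mono:
  assumes "\<And>x y. x \<in> set p \<Longrightarrow> y \<in> set p \<Longrightarrow> c x y \<le> c' x y" "\<And>x y. 0 \<le> c x y" "0 < M"
  shows "path_weight c M p \<le> path_weight c' M p"
  using assms
proof (induction c M p rule: path_weight.induct)
  case (1 c M x y p)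
  have "path_weight c M (y # p) \<le> path_weight c' M (y # p)"
    using 1 by simp
  moreover have "c x y / M \<le> c' x y / M" "0 \<le> c x y / M" "0 \<le> c' x y / M"
    using 1 order_trans[of 0 "c x y" "c' x y"] by (auto intro: divide_right_mono)
  ultimately show ?case
    using path_weight_nonneg[of c M "y # p"] 1(3,4) unfolding path_weight.simps
    by (intro mult_mono) auto
qed auto

text \<open>The edges from \<open>a\<close> to \<open>v\<close> and from \<open>v\<close> to
  \<open>b\<close> merge into one, which receives at least \<open>c a v * c v b / C\<close> with
  \<open>C \<le> M\<close>; all other edges can only gain. Distinctness keeps \<open>v\<close> out
  of the rest of the path and ensures \<open>a \<noteq> b\<close>, so that the new edge is off the
  diagonal.\<close>

lemma path_weight_eliminate:
  assumes net: "network (insert v W) c" and v: "v \<notin> W" and M: "0 < M"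
    and row: "(\<Sum>z\<in>insert v W. c v z) \<le> M"
    and p: "distinct (p @ a # v # b # r)"
  shows "path_weight c M (p @ a # v # b # r)
    \<le> path_weight (eliminate (insert v W) v c) M (p @ a # b # r)"
proof -
  let ?e = "eliminate (insert v W) v c"
  have nn: "\<And>x y. 0 \<le> c x y" using net by (auto simp: network_def)
  have nne: "\<And>x y. 0 \<le> ?e x y" using network_eliminate[OF net] by (auto simp: network_def)
  define C where "C = (\<Sum>z\<in>insert v W. c v z)"
  have C0: "C \<ge> 0" by (simp add: C_def sum_nonneg nn)
  have "c a v * c v b / M \<le> c a v * c v b / C"
  proof (cases "C = 0")
    case True
    then have "c v b = 0"
      using network_row_sum_zero[OF net] by (simp add: C_def)
    then show ?thesis by simp
  next
    case False
    then show ?thesis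
      using C0 row nn M by (intro divide_left_mono) (auto simp: C_def)
  qed
  also have "\<dots> \<le> ?e a b"
    using p nn by (auto simp: eliminate_def C_def)
  finally have "c a v * c v b / M \<le> ?e a b" .
  from divide_right_mono[OF this, of M] have ab: "c a v / M * (c v b / M) \<le> ?e a b / M"
    using M by simp
  have "path_weight c M (p @ a # v # b # r)
      = path_weight c M (p @ [a]) * ((c a v / M * (c v b / M)) * path_weight c M (b # r))"
    by (subst path_weight_append) simp
  also have "\<dots> \<le> path_weight ?e M (p @ [a]) * ((?e a b / M) * path_weight ?e M (b # r))"
  proof (intro mult_mono)
    show "path_weight c M (p @ [a]) \<le> path_weight ?e M (p @ [a])"
      using p by (intro path_weight_mono eliminate_ge[OF net] nn M) auto
    show "path_weight c M (b # r) \<le> path_weight ?e M (b # r)"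
      using p by (intro path_weight_mono eliminate_ge[OF net] nn M) auto
    show "c a v / M * (c v b / M) \<le> ?e a b / M" by (rule ab)
    show "0 \<le> path_weight ?e M (p @ [a])" by (rule path_weight_nonneg[OF nne M])
    show "0 \<le> path_weight c M (b # r)" by (rule path_weight_nonneg[OF nn M])
    show "0 \<le> ?e a b / M" using nne[of a b] M by simp
    show "0 \<le> c a v / M * (c v b / M) * path_weight c M (b # r)"
      using M path_weight_nonneg[OF nn M] by (intro mult_nonneg_nonneg divide_nonneg_nonneg nn) auto
  qed
  also have "\<dots> = path_weight ?e M (p @ a # b # r)"
    by (subst path_weight_append[of ?e M p a]) simp
  finally show ?thesis .
qed

text \<open>Simple paths between two different points of \<open>A\<close> whose interior avoids
  \<open>A\<close>. The endpoints are read off the list, as they stay the same while interior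
  vertices are removed.\<close>

definition crossing :: "'a set \<Rightarrow> 'a set \<Rightarrow> 'a list \<Rightarrow> bool" where
  "crossing A V p \<longleftrightarrow> p \<noteq> [] \<and> hd p \<in> A \<and> last p \<in> A \<and> hd p \<noteq> last p \<and> distinct p \<and>
     set p \<subseteq> V \<and> set p \<inter> A \<subseteq> {hd p, last p}"

lemma crossing_eliminate:
  assumes net: "network (insert v (A \<union> B)) c" and v: "v \<notin> A \<union> B" and M: "0 < M"
    and row: "(\<Sum>z\<in>insert v (A \<union> B). c v z) \<le> M"
    and p: "crossing A (insert v (A \<union> B)) p"
  obtains p' where "crossing A (A \<union> B) p'" "hd p' = hd p" "last p' = last p"
    "path_weight c M p \<le> path_weight (eliminate (insert v (A \<union> B)) v c) M p'"
proof (cases "v \<in> set p")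
  case False
  then have "crossing A (A \<union> B) p"
    using p by (auto simp: crossing_def)
  moreover have "path_weight c M p \<le> path_weight (eliminate (insert v (A \<union> B)) v c) M p"
    using False M net by (intro path_weight_mono eliminate_ge[OF net]) (auto simp: network_def)
  ultimately show ?thesis using that by blast
next
  case True
  then obtain s t where st: "p = s @ v # t" by (meson split_list)
  \<comment> \<open>The endpoints lie in \<open>A\<close> and \<open>v\<close> does not, so
    \<open>v\<close> has a neighbour on either side.\<close>
  have "s \<noteq> []" "t \<noteq> []"
    using p v st by (auto simp: crossing_def)
  then obtain s' a b r where ab: "s = s' @ [a]" "t = b # r"
    by (metis append_butlast_last_id neq_Nil_conv)
  have eq: "p = s' @ a # v # b # r" using st ab by simp
  let ?p = "s' @ a # b # r"
  have hl: "hd ?p = hd p" "last ?p = last p"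
    by (cases s'; simp add: eq)+
  have "crossing A (A \<union> B) ?p"
    using p hl unfolding crossing_def by (auto simp: eq)
  moreover have "path_weight c M p \<le> path_weight (eliminate (insert v (A \<union> B)) v c) M ?p"
    unfolding eq using p by (intro path_weight_eliminate[OF net v M row]) (auto simp: crossing_def eq)
  ultimately show ?thesis using that hl by blast
qed

text \<open>With no vertex outside \<open>A\<close> left, every vertex of the path is an endpoint,
  and distinctness leaves exactly two.\<close>

lemma crossing_subset_Nil:
  assumes "crossing A A p"
  shows "p = [hd p, last p]"
proof -
  have p: "set p \<subseteq> {hd p, last p}" "distinct p" "p \<noteq> []" "hd p \<noteq> last p"
    using assms by (auto simp: crossing_def)
  then obtain x s y where "p = x # s @ [y]"
    by (metis append_butlast_last_id append_Cons hd_Cons_tl last_ConsL last_tl list.sel(3))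
  then show ?thesis using p by (cases s) auto
qed

text \<open>The two energy clauses together say that \<open>dirichlet A c' f\<close> is the least
  energy of an extension of \<open>f\<close> to the whole network. In the induction \<open>c\<close>
  varies with each elimination, while \<open>M\<close> stays fixed since row sums never
  grow.\<close>

lemma network_trace:
  assumes "finite B" "A \<inter> B = {}" "network (A \<union> B) c" "0 < M"
    and "\<And>x. x \<in> A \<union> B \<Longrightarrow> (\<Sum>y\<in>A \<union> B. c x y) \<le> M"
  obtains c' where "network A c'"
    "\<And>u. dirichlet A c' u \<le> dirichlet (A \<union> B) c u"
    "\<And>f. \<exists>u. (\<forall>x\<in>A. u x = f x) \<and> dirichlet (A \<union> B) c u = dirichlet A c' f"
    "\<And>p. crossing A (A \<union> B) p \<Longrightarrow> path_weight c M p \<le> c' (hd p) (last p) / M"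
  using assms
proof (induction B arbitrary: c thesis rule: finite_induct)
  case empty
  have "path_weight c M p \<le> c (hd p) (last p) / M" if "crossing A A p" for p
  proof -
    have "path_weight c M [hd p, last p] \<le> c (hd p) (last p) / M" by simp
    then show ?thesis using crossing_subset_Nil[OF that] by simp
  qed
  then show ?case using empty by (intro empty(1)[of c]) auto
next
  case (insert v B)
  let ?V = "insert v (A \<union> B)" and ?e = "eliminate (insert v (A \<union> B)) v c"
  have v: "v \<notin> A \<union> B" using insert by auto
  have net: "network ?V c" using insert by simp
  have row: "(\<Sum>y\<in>?V. c x y) \<le> M" if "x \<in> ?V" for x using insert.prems(5)[of x] that by simp
  have "(\<Sum>y\<in>A \<union> B. ?e x y) \<le> M" if "x \<in> A \<union> B" for x
    using row_sum_eliminate_le[OF net v that] row[of x] that by simp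
  then obtain c' where net': "network A c'"
    and le: "\<And>u. dirichlet A c' u \<le> dirichlet (A \<union> B) ?e u"
    and ex: "\<And>f. \<exists>u. (\<forall>x\<in>A. u x = f x) \<and> dirichlet (A \<union> B) ?e u = dirichlet A c' f"
    and cr: "\<And>p. crossing A (A \<union> B) p \<Longrightarrow> path_weight ?e M p \<le> c' (hd p) (last p) / M"
    using insert.IH[of ?e] insert.prems(2,4) network_eliminate[OF net] by blast
  define C where "C = (\<Sum>z\<in>?V. c v z)"
  have C0: "0 \<le> C" using net by (auto simp: C_def network_def intro!: sum_nonneg)
  note step = dirichlet_eliminate[OF net v, folded C_def]
  show ?case
  proof (rule insert.prems(1)[of c'])
    show "network A c'" by (rule net')
  next
    fix u
    have "dirichlet (A \<union> B) ?e u \<le> dirichlet ?V c u"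
      using C0 by (simp add: step)
    then show "dirichlet A c' u \<le> dirichlet (A \<union> insert v B) c u"
      using le[of u] by simp
  next
    fix f
    obtain u where u: "\<forall>x\<in>A. u x = f x" "dirichlet (A \<union> B) ?e u = dirichlet A c' f"
      using ex by blast
    \<comment> \<open>The weighted mean makes the extra square in \<open>step\<close> vanish; for
      \<open>C = 0\<close> its factor already does.\<close>
    define w where "w = u(v := (\<Sum>x\<in>A \<union> B. c v x * u x) / C)"
    have w: "w x = u x" if "x \<in> A \<union> B" for x using that v by (auto simp: w_def)
    have "(\<Sum>x\<in>A \<union> B. c v x * w x) = (\<Sum>x\<in>A \<union> B. c v x * u x)"
      by (intro sum.cong refl) (simp add: w)
    then have "dirichlet ?V c w = dirichlet (A \<union> B) ?e w"
      unfolding step by (simp add: w_def)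
    also have "\<dots> = dirichlet A c' f"
      using u(2) dirichlet_cong[of "A \<union> B" w u] w by simp
    finally show "\<exists>u. (\<forall>x\<in>A. u x = f x) \<and> dirichlet (A \<union> insert v B) c u = dirichlet A c' f"
      using u(1) w by (intro exI[of _ w]) auto
  next
    fix p assume "crossing A (A \<union> insert v B) p"
    then have "crossing A ?V p" by simp
    then obtain p' where "crossing A (A \<union> B) p'" "hd p' = hd p" "last p' = last p"
      "path_weight c M p \<le> path_weight ?e M p'"
      using crossing_eliminate[OF net v insert.prems(4) row[of v]] by blast
    then show "path_weight c M p \<le> c' (hd p) (last p) / M"
      using cr[of p'] by simp
  qed
qed

text \<open>Polarization at two indicator functions isolates a single coefficient.\<close>

lemma dirichlet_determines:
  assumes A: "finite A" and eq: "\<And>f. dirichlet A c f = dirichlet A c' f"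
    and sym: "\<And>x y. c x y = c y x" "\<And>x y. c' x y = c' y x"
    and xy: "x \<in> A" "y \<in> A" "x \<noteq> y"
  shows "c x y = c' x y"
proof -
  define e where "e z = (\<lambda>a. if a = z then 1 else 0 :: real)" for z :: 'a
  have polar: "dirichlet A d (\<lambda>a. e x a + e y a) - dirichlet A d (e x) - dirichlet A d (e y) = - 2 * d x y"
    if sym: "\<And>x y. d x y = d y x" for d
  proof -
    have "dirichlet A d (\<lambda>a. e x a + e y a) - dirichlet A d (e x) - dirichlet A d (e y)
      = (\<Sum>a\<in>A. \<Sum>b\<in>A. d a b * ((e x a + e y a - (e x b + e y b))\<^sup>2
          - (e x a - e x b)\<^sup>2 - (e y a - e y b)\<^sup>2)) / 2"
      unfolding dirichlet_def by (simp add: sum_subtractf algebra_simps diff_divide_distrib add_divide_distrib sum.distrib)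
    also have "\<dots> = (\<Sum>a\<in>A. \<Sum>b\<in>A. (if a = x then if b = y then - 2 * d x y else 0 else 0)
        + (if a = y then if b = x then - 2 * d x y else 0 else 0)) / 2"
      by (intro arg_cong2[where f="(/)"] sum.cong refl)
         (use xy sym in \<open>auto simp: e_def\<close>)
    also have "\<dots> = - 2 * d x y"
    proof -
      have double: "(\<Sum>a\<in>A. \<Sum>b\<in>A. if a = r then if b = s then k else 0 else 0) = k"
        if "r \<in> A" "s \<in> A" for r s and k :: real
      proof -
        have "(\<Sum>b\<in>A. if a = r then if b = s then k else 0 else 0) = (if a = r then k else 0)" for a
          using that A by (cases "a = r") simp_all
        then show ?thesis using that A by simp
      qed
      show ?thesis
        unfolding sum.distrib double[OF xy(1,2)] double[OF xy(2,1)] by simp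
    qed
    finally show ?thesis .
  qed
  show ?thesis using polar[of c] polar[of c'] sym eq by simp
qed

subsection \<open>Geometry of the gasket\<close>

text \<open>The median length formula. The correction does not depend on \<open>p\<close>, which is
  what makes differences of squared distances affine.\<close>

lemma dist_midpoint_sq:
  fixes x y p :: "'a::real_inner"
  shows "(dist ((1 / 2) *\<^sub>R (x + y)) p)\<^sup>2 = ((dist x p)\<^sup>2 + (dist y p)\<^sup>2) / 2 - (dist x y)\<^sup>2 / 4"
  by (simp add: dist_norm power2_norm_eq_inner inner_simps inner_commute field_simps)

lemma inj_sg_map: "inj (sg_map q i)"
  by (auto simp: inj_def sg_map_def)

lemma continuous_on_sg_map: "continuous_on S (sg_map q i)"
  unfolding sg_map_def by (intro continuous_intros)

lemma sg_map_fixes: "sg_map q i (q i) = q i"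
  by (simp add: sg_map_def scaleR_2 [symmetric])

lemma sg_map_swap: "sg_map q i (q j) = sg_map q j (q i)"
  by (simp add: sg_map_def add.commute)

lemma dist_sg_map: "dist (sg_map q i x) (sg_map q i y) = dist x y / 2"
proof -
  have "sg_map q i x - sg_map q i y = (1 / 2) *\<^sub>R (x - y)"
    by (simp add: sg_map_def algebra_simps)
  then show ?thesis by (simp add: dist_norm)
qed

definition sg_inv :: "(3 \<Rightarrow> real ^ 2) \<Rightarrow> 3 \<Rightarrow> real ^ 2 \<Rightarrow> real ^ 2" where
  "sg_inv q i x = 2 *\<^sub>R x - q i"

lemma sg_inv_sg_map [simp]: "sg_inv q i (sg_map q i x) = x"
  by (simp add: sg_inv_def sg_map_def)

lemma sg_map_sg_inv [simp]: "sg_map q i (sg_inv q i x) = x"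
  by (simp add: sg_inv_def sg_map_def)

lemma finite_vertices: "finite (vertices q m)"
  by (induction m) auto

lemma vertices_Suc_mono: "vertices q m \<subseteq> vertices q (Suc m)"
proof (induction m)
  case 0
  have "q i \<in> sg_map q i ` range q" for i
    using sg_map_fixes[of q i] by (metis imageI rangeI)
  then show ?case by auto
next
  case (Suc m)
  then show ?case by fastforce
qed

lemma corner_in_vertices: "q i \<in> vertices q m"
proof (induction m)
  case (Suc m)
  then show ?case using vertices_Suc_mono by blast
qed simp

text \<open>The largest distance from a point of \<open>K\<close> to \<open>L\<close> is attained.
  Every map halves distances and preserves \<open>L\<close>, so this maximum is at most half of
  itself and hence zero.\<close>

lemma self_similar_subset:
  assumes K: "K \<noteq> {}" "compact K" "K = (\<Union>i. sg_map q i ` K)"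
    and L: "L \<noteq> {}" "compact L" "L = (\<Union>i. sg_map q i ` L)"
  shows "K \<subseteq> L"
proof -
  have "continuous_on K (\<lambda>x. infdist x L)" by (intro continuous_intros)
  then obtain x where x: "x \<in> K" and max: "\<And>y. y \<in> K \<Longrightarrow> infdist y L \<le> infdist x L"
    using continuous_attains_sup[of K "\<lambda>x. infdist x L"] K by blast
  obtain i y where y: "y \<in> K" "x = sg_map q i y" using x K(3) by blast
  obtain z where z: "z \<in> L" "infdist y L = dist y z"
    using infdist_attains_inf[of L y] L compact_imp_closed by blast
  have "sg_map q i z \<in> L" using z(1) L(3) by blast
  then have "infdist x L \<le> dist x (sg_map q i z)" by (rule infdist_le)
  also have "\<dots> = infdist y L / 2" using z(2) y(2) by (simp add: dist_sg_map)
  also have "\<dots> \<le> infdist x L / 2" using max[OF y(1)] by simp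
  finally have "infdist x L \<le> 0" by simp
  then have "infdist w L = 0" if "w \<in> K" for w
    using max[OF that] infdist_nonneg[of w L] by linarith
  then show ?thesis
    using L compact_imp_closed in_closed_iff_infdist_zero by blast
qed

section \<open>Barycentric coordinates and the triangle\<close>

locale gasket =
  fixes q :: "3 \<Rightarrow> real ^ 2"
  assumes equilateral: "equilateral q"
begin

definition side :: real where "side = (SOME s. s > 0 \<and> (\<forall>i j. i \<noteq> j \<longrightarrow> dist (q i) (q j) = s))"

lemma side_pos: "side > 0" and dist_corners: "dist (q i) (q j) = (if i = j then 0 else side)"
proof -
  have "\<exists>s. s > 0 \<and> (\<forall>i j. i \<noteq> j \<longrightarrow> dist (q i) (q j) = s)"
    using equilateral by (auto simp: equilateral_def)
  then have "side > 0 \<and> (\<forall>i j. i \<noteq> j \<longrightarrow> dist (q i) (q j) = side)"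
    unfolding side_def by (rule someI_ex)
  then show "side > 0" "dist (q i) (q j) = (if i = j then 0 else side)" by simp_all
qed

text \<open>
  Barycentric coordinates, written with squared distances: the quadratic parts cancel, so this is
  affine in \<open>x\<close>.
\<close>

definition bary :: "3 \<Rightarrow> real ^ 2 \<Rightarrow> real" where
  "bary j x = 1 / 3 - ((dist x (q j))\<^sup>2 - (\<Sum>k\<in>UNIV. (dist x (q k))\<^sup>2) / 3) / side\<^sup>2"

lemma sum_bary: "(\<Sum>j\<in>UNIV. bary j x) = 1"
proof -
  define S where "S = (\<Sum>k\<in>UNIV. (dist x (q k))\<^sup>2)"
  have "(\<Sum>j\<in>UNIV. bary j x) = 1 - (S - (\<Sum>j\<in>(UNIV :: 3 set). S / 3)) / side\<^sup>2"
    unfolding bary_def sum_subtractf sum_divide_distrib[symmetric] S_def by simp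
  then show ?thesis by simp
qed

lemma bary_corner: "bary j (q i) = (if i = j then 1 else 0)"
proof -
  have "(\<Sum>k\<in>UNIV. (dist (q i) (q k))\<^sup>2) = (\<Sum>k\<in>UNIV. side\<^sup>2 - (if i = k then side\<^sup>2 else 0))"
    by (intro sum.cong refl) (simp add: dist_corners)
  also have "\<dots> = 2 * side\<^sup>2"
    by (simp add: sum_subtractf)
  finally show ?thesis
    using side_pos by (simp add: bary_def dist_corners field_simps)
qed

text \<open>The correction \<open>d\<close> in the midpoint formula is the same for all three
  corners, so subtracting the average over the corners cancels it.\<close>

lemma bary_sg_map: "bary j (sg_map q i x) = (bary j x + (if i = j then 1 else 0)) / 2"
proof -
  have "bary j (sg_map q i x) = (bary j x + bary j (q i)) / 2"
  proof -
    define S d where "S = (\<lambda>y. \<Sum>k\<in>UNIV. (dist y (q k))\<^sup>2)" and "d = (dist x (q i))\<^sup>2 / 4"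
    have "S (sg_map q i x) = (\<Sum>k\<in>UNIV. ((dist x (q k))\<^sup>2 + (dist (q i) (q k))\<^sup>2) / 2 - d)"
      by (simp only: S_def sg_map_def dist_midpoint_sq d_def)
    also have "\<dots> = (S x + S (q i)) / 2 - 3 * d"
      unfolding S_def sum_subtractf sum_divide_distrib[symmetric] sum.distrib by simp
    finally have S: "S (sg_map q i x) = (S x + S (q i)) / 2 - 3 * d" .
    have b: "bary j y = 1 / 3 - ((dist y (q j))\<^sup>2 - S y / 3) / side\<^sup>2" for y
      by (simp add: bary_def S_def)
    have D: "(dist (sg_map q i x) (q j))\<^sup>2 = ((dist x (q j))\<^sup>2 + (dist (q i) (q j))\<^sup>2) / 2 - d"
      by (simp only: sg_map_def dist_midpoint_sq d_def)
    show ?thesis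
      unfolding b S D using side_pos by (simp add: field_simps)
  qed
  then show ?thesis by (simp add: bary_corner)
qed

lemma continuous_on_bary: "continuous_on S (bary j)"
  unfolding bary_def using side_pos by (intro continuous_intros) auto

text \<open>The convex hull of the corners. The reconstruction of \<open>x\<close> from its
  coordinates is built in, as it holds at the corners and is inherited along
  \<open>sg_map\<close>.\<close>

definition triangle :: "(real ^ 2) set" where
  "triangle = {x. (\<forall>j. 0 \<le> bary j x) \<and> x = (\<Sum>j\<in>UNIV. bary j x *\<^sub>R q j)}"

lemma bary_nonneg: "x \<in> triangle \<Longrightarrow> 0 \<le> bary j x"
  and bary_sum: "x \<in> triangle \<Longrightarrow> (\<Sum>j\<in>UNIV. bary j x *\<^sub>R q j) = x"
  unfolding triangle_def by blast simp

lemma triangleI: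
  "(\<And>j. 0 \<le> bary j x) \<Longrightarrow> (\<Sum>j\<in>UNIV. bary j x *\<^sub>R q j) = x \<Longrightarrow> x \<in> triangle"
  by (simp add: triangle_def)

lemma bary_le_one: "x \<in> triangle \<Longrightarrow> bary j x \<le> 1"
  using sum_bary[of x] member_le_sum[of j UNIV "\<lambda>j. bary j x"] by (simp add: bary_nonneg)

lemma triangle_corner: "q i \<in> triangle"
proof -
  have "(\<Sum>j\<in>UNIV. bary j (q i) *\<^sub>R q j) = (\<Sum>j\<in>UNIV. if i = j then q j else 0)"
    by (intro sum.cong refl) (simp add: bary_corner)
  then show ?thesis by (intro triangleI) (simp_all add: bary_corner)
qed

lemma triangle_sg_map:
  assumes "x \<in> triangle"
  shows "sg_map q i x \<in> triangle"
proof -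
  have "(\<Sum>j\<in>UNIV. bary j (sg_map q i x) *\<^sub>R q j)
      = (\<Sum>j\<in>UNIV. (1 / 2) *\<^sub>R (bary j x *\<^sub>R q j) + (1 / 2) *\<^sub>R (if i = j then q j else 0))"
    by (intro sum.cong refl) (simp add: bary_sg_map scaleR_add_left add_divide_distrib)
  also have "\<dots> = sg_map q i x"
    unfolding sum.distrib scaleR_sum_right[symmetric]
    by (simp add: sg_map_def scaleR_add_right bary_sum[OF assms])
  finally show ?thesis
    by (intro triangleI) (simp_all add: bary_sg_map bary_nonneg[OF assms])
qed

lemma closed_triangle: "closed triangle"
proof -
  have 1: "closed {x. \<forall>j. 0 \<le> bary j x}"
    by (intro closed_Collect_all closed_Collect_le continuous_on_bary continuous_intros)
  have 2: "closed {x. x = (\<Sum>j\<in>UNIV. bary j x *\<^sub>R q j)}"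
    by (intro closed_Collect_eq continuous_intros continuous_on_bary)
  have "triangle = {x. \<forall>j. 0 \<le> bary j x} \<inter> {x. x = (\<Sum>j\<in>UNIV. bary j x *\<^sub>R q j)}"
    by (auto simp: triangle_def)
  then show ?thesis using 1 2 by auto
qed

lemma bounded_triangle: "bounded triangle"
proof (rule boundedI)
  fix x assume x: "x \<in> triangle"
  have "norm x = norm (\<Sum>j\<in>UNIV. bary j x *\<^sub>R q j)"
    by (simp add: bary_sum[OF x])
  also have "\<dots> \<le> (\<Sum>j\<in>UNIV. norm (q j))"
  proof (rule sum_norm_le)
    fix j
    show "norm (bary j x *\<^sub>R q j) \<le> norm (q j)"
      using bary_le_one[OF x, of j] bary_nonneg[OF x, of j] mult_right_mono[of "bary j x" 1 "norm (q j)"]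
      by simp
  qed
  finally show "norm x \<le> (\<Sum>j\<in>UNIV. norm (q j))" .
qed

text \<open>Comparing the \<open>j\<close>-th coordinates of both sides gives
  \<open>bary j x = bary j y + 1\<close>. As coordinates lie between 0 and 1,
  \<open>bary j x\<close> is 1 and the others vanish. Exchanging the roles yields
  \<open>y = q i\<close>.\<close>

lemma cells_meet_at_corner:
  assumes x: "x \<in> triangle" and y: "y \<in> triangle" and ij: "i \<noteq> j"
    and eq: "sg_map q i x = sg_map q j y"
  shows "x = q j"
proof -
  have "bary j (sg_map q i x) = bary j (sg_map q j y)" using eq by simp
  then have "bary j x = bary j y + 1" using ij by (simp add: bary_sg_map)
  then have j: "bary j x = 1"
    using bary_nonneg[OF y, of j] bary_le_one[OF x, of j] by simp
  have k: "bary k x = 0" if "k \<noteq> j" for k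
  proof -
    have "bary j x + (\<Sum>k\<in>UNIV - {j}. bary k x) = 1"
      using sum_bary[of x] by (simp add: sum.remove)
    then have "(\<Sum>k\<in>UNIV - {j}. bary k x) = 0" using j by simp
    then show ?thesis
      using that by (subst (asm) sum_nonneg_eq_0_iff) (auto simp: bary_nonneg[OF x])
  qed
  have "x = (\<Sum>k\<in>UNIV. bary k x *\<^sub>R q k)" by (simp add: bary_sum[OF x])
  also have "\<dots> = (\<Sum>k\<in>UNIV. if j = k then q k else 0)"
    by (intro sum.cong refl) (use j k in auto)
  finally show ?thesis by simp
qed

lemma vertices_subset_triangle: "vertices q m \<subseteq> triangle"
  by (induction m) (auto intro: triangle_corner triangle_sg_map)

lemma inj_corners: "inj q"
  using dist_corners side_pos by (auto simp: inj_def) (metis dist_self less_irrefl)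

section \<open>The gasket as the closure of the set of all vertices\<close>

definition skeleton :: "(real ^ 2) set" where
  "skeleton = (\<Union>m. vertices q m)"

lemma skeleton_self_similar: "skeleton = (\<Union>i. sg_map q i ` skeleton)"
proof -
  have "(\<Union>i. sg_map q i ` skeleton) = (\<Union>m. vertices q (Suc m))"
    by (auto simp: skeleton_def)
  also have "\<dots> = skeleton"
    unfolding skeleton_def using vertices_Suc_mono[of q] by blast
  finally show ?thesis by simp
qed

lemma closure_skeleton_subset: "closure skeleton \<subseteq> triangle"
  using vertices_subset_triangle by (intro closure_minimal closed_triangle) (auto simp: skeleton_def)

lemma compact_closure_skeleton: "compact (closure skeleton)"
  using closure_skeleton_subset bounded_triangle bounded_subset compact_eq_bounded_closed by blast

lemma closure_skeleton_self_similar: "closure skeleton = (\<Union>i. sg_map q i ` closure skeleton)"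
proof
  have "closed (\<Union>i. sg_map q i ` closure skeleton)"
    by (intro closed_UN finite compact_imp_closed compact_continuous_image
        continuous_on_sg_map compact_closure_skeleton ballI)
  moreover have "skeleton \<subseteq> (\<Union>i. sg_map q i ` closure skeleton)"
    using skeleton_self_similar closure_subset[of skeleton] by blast
  ultimately show "closure skeleton \<subseteq> (\<Union>i. sg_map q i ` closure skeleton)"
    by (rule closure_minimal[rotated])
next
  have "sg_map q i ` closure skeleton \<subseteq> closure skeleton" for i
  proof (rule image_closure_subset[OF continuous_on_sg_map])
    show "sg_map q i ` skeleton \<subseteq> closure skeleton"
      using skeleton_self_similar closure_subset[of skeleton] by blast
  qed simp
  then show "(\<Union>i. sg_map q i ` closure skeleton) \<subseteq> closure skeleton" by blast
qed

text \<open>The closure is a compact self-similar set, and \<open>self_similar_subset\<close> in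
  both directions gives uniqueness, so the definite description is resolved.\<close>

lemma SG_eq: "SG q = closure skeleton"
  unfolding SG_def
proof (rule the_equality)
  have "skeleton \<noteq> {}" using corner_in_vertices[of q] by (auto simp: skeleton_def)
  then have ne: "closure skeleton \<noteq> {}" by simp
  then show *: "closure skeleton \<noteq> {} \<and> compact (closure skeleton) \<and>
      closure skeleton = (\<Union>i. sg_map q i ` closure skeleton)"
    using compact_closure_skeleton closure_skeleton_self_similar by blast
  fix K assume "K \<noteq> {} \<and> compact K \<and> K = (\<Union>i. sg_map q i ` K)"
  then show "K = closure skeleton"
    using self_similar_subset[of K q "closure skeleton"] self_similar_subset[of "closure skeleton" q K] *
    by (intro equalityI) (elim conjE, assumption?)+
qed

lemma vertices_subset_SG: "vertices q m \<subseteq> SG q"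
  using closure_subset[of skeleton] by (auto simp: SG_eq skeleton_def)

lemma SG_subset_triangle: "SG q \<subseteq> triangle"
  using closure_skeleton_subset by (simp add: SG_eq)

lemma compact_SG: "compact (SG q)"
  using compact_closure_skeleton by (simp add: SG_eq)

lemma SG_self_similar: "SG q = (\<Union>i. sg_map q i ` SG q)"
  using closure_skeleton_self_similar by (simp add: SG_eq)

lemma sg_map_SG: "x \<in> SG q \<Longrightarrow> sg_map q i x \<in> SG q"
  using SG_self_similar by blast

lemma corner_SG: "q i \<in> SG q"
  using vertices_subset_SG[of 0] by auto

end

subsection \<open>Energy and harmonic extension\<close>

lemma adj_sym: "adj q m x y \<Longrightarrow> adj q m y x"
  by (auto simp: adj_def)

lemma adj_0: "adj q 0 x y \<longleftrightarrow> x \<noteq> y \<and> x \<in> range q \<and> y \<in> range q"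
  by (simp add: adj_def)

text \<open>The first letter of a word is its outermost map; splitting it off makes induction over
  the level possible.\<close>

lemma adj_Suc:
  "adj q (Suc m) x y \<longleftrightarrow> (\<exists>i x' y'. x = sg_map q i x' \<and> y = sg_map q i y' \<and> adj q m x' y')"
  (is "_ \<longleftrightarrow> ?R")
proof
  assume "adj q (Suc m) x y"
  then obtain w' where w': "length w' = Suc m" "x \<noteq> y" "x \<in> word_map q w' ` vertices q 0"
      "y \<in> word_map q w' ` vertices q 0"
    unfolding adj_def by blast
  then obtain i w where "w' = i # w" by (cases w') auto
  with w' have w: "length w = m" "x \<noteq> y" "x \<in> word_map q (i # w) ` vertices q 0"
      "y \<in> word_map q (i # w) ` vertices q 0"
    by auto
  then obtain x' y' where "x = sg_map q i x'" "y = sg_map q i y'"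
      "x' \<in> word_map q w ` vertices q 0" "y' \<in> word_map q w ` vertices q 0"
    by auto
  moreover from this have "adj q m x' y'"
    using w(1,2) unfolding adj_def by blast
  ultimately show ?R by blast
next
  assume ?R
  then obtain i x' y' w where *: "x = sg_map q i x'" "y = sg_map q i y'" "x' \<noteq> y'" "length w = m"
      "x' \<in> word_map q w ` vertices q 0" "y' \<in> word_map q w ` vertices q 0"
    by (auto simp: adj_def)
  then have "x \<noteq> y" using inj_sg_map[of q i] by (auto dest: injD)
  moreover have "x \<in> word_map q (i # w) ` vertices q 0" "y \<in> word_map q (i # w) ` vertices q 0"
    using * by auto
  moreover have "length (i # w) = Suc m" using * by simp
  ultimately show "adj q (Suc m) x y" unfolding adj_def by blast
qed

lemma adj_vertices: "adj q m x y \<Longrightarrow> x \<in> vertices q m \<and> y \<in> vertices q m"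
proof (induction m arbitrary: x y)
  case (Suc m)
  then show ?case by (auto simp: adj_Suc)
qed (simp add: adj_0)

text \<open>Ordered pairs, so every edge occurs twice, in accordance with the factor 1/2 in
  \<open>level_energy\<close>.\<close>

definition edges :: "(3 \<Rightarrow> real ^ 2) \<Rightarrow> nat \<Rightarrow> ((real ^ 2) \<times> (real ^ 2)) set" where
  "edges q m = {(x, y). adj q m x y}"

lemma finite_edges: "finite (edges q m)"
  by (rule finite_subset[of _ "vertices q m \<times> vertices q m"])
     (auto simp: edges_def finite_vertices dest: adj_vertices)

lemma edges_Suc:
  "edges q (Suc m) = (\<Union>i. map_prod (sg_map q i) (sg_map q i) ` edges q m)"
  by (fastforce simp: edges_def adj_Suc)

lemma level_energy_edges:
  "level_energy q m u = (5 / 3) ^ m * ((\<Sum>(x, y)\<in>edges q m. (u x - u y)\<^sup>2) / 2)"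
proof -
  have "(SIGMA x:vertices q m. {y \<in> vertices q m. adj q m x y}) = edges q m"
    by (auto simp: edges_def dest: adj_vertices)
  then show ?thesis
    by (simp add: level_energy_def sum.Sigma finite_vertices)
qed

lemma level_energy_cong:
  "(\<And>x. x \<in> vertices q m \<Longrightarrow> u x = w x) \<Longrightarrow> level_energy q m u = level_energy q m w"
  by (simp add: level_energy_def)

text \<open>Numerals of type \<open>3\<close> are read modulo three, so 1, 2 and 3 are all of its
  elements.\<close>

definition triangle_energy :: "(3 \<Rightarrow> real) \<Rightarrow> real" where
  "triangle_energy v = (v 1 - v 2)\<^sup>2 + (v 1 - v 3)\<^sup>2 + (v 2 - v 3)\<^sup>2"

text \<open>The 1/5--2/5 rule for harmonic functions: the coefficients are \<open>2/5\<close> at \<open>i\<close> and \<open>j\<close>, \<open>1/5\<close> at the third corner.\<close>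

definition cell_values :: "3 \<Rightarrow> (3 \<Rightarrow> real) \<Rightarrow> 3 \<Rightarrow> real" where
  "cell_values i v j = (if j = i then v i else (v i + v j + (\<Sum>k\<in>UNIV. v k)) / 5)"

lemma cell_values_swap: "cell_values i v j = cell_values j v i"
  by (simp add: cell_values_def add.commute)

text \<open>Here \<open>w i j\<close> is the value at the image of corner \<open>j\<close> in cell
  \<open>i\<close>, and symmetry says that the cells agree at the midpoints. The harmonic values
  minimize the refined energy, so the cross terms with the deviation cancel; the minimum is 3/5 of
  the coarse energy, which the factor 5/3 offsets.\<close>

lemma refined_triangle_energy:
  assumes "\<And>i. w i i = v i" "\<And>i j. w i j = w j i"
  shows "5 / 3 * (\<Sum>i\<in>UNIV. triangle_energy (w i)) = triangle_energy v +
    5 / 3 * (\<Sum>i\<in>UNIV. triangle_energy (\<lambda>j. w i j - cell_values i v j))"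
proof -
  have w: "w 1 1 = v 1" "w 2 2 = v 2" "w 3 3 = v 3" "w 2 1 = w 1 2" "w 3 1 = w 1 3" "w 3 2 = w 2 3"
    using assms by auto
  show ?thesis
    by (simp add: triangle_energy_def cell_values_def sum_3 w power2_eq_square field_simps)
qed

text \<open>The worst case is a corner against a midpoint, with difference
  \<open>(2 * (v i - v j) + (v i - v k)) / 5\<close> for the third corner \<open>k\<close>. Two
  midpoints differ by only a fifth of a difference of corner values.\<close>

lemma cell_values_contract:
  assumes "\<And>j k. \<bar>v j - v k\<bar> \<le> d"
  shows "\<bar>cell_values i v j - cell_values i v k\<bar> \<le> 3 / 5 * d"
proof -
  have "\<bar>v 1 - v 2\<bar> \<le> d" "\<bar>v 1 - v 3\<bar> \<le> d" "\<bar>v 2 - v 3\<bar> \<le> d"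
    using assms by auto
  then show ?thesis
    using exhaust_3[of i] exhaust_3[of j] exhaust_3[of k]
    by (elim disjE) (simp_all add: cell_values_def sum_3 abs_le_iff field_simps)
qed

lemma triangle_energy_cell_values:
  "5 / 3 * (\<Sum>i\<in>UNIV. triangle_energy (cell_values i v)) = triangle_energy v"
  using refined_triangle_energy[of "\<lambda>i. cell_values i v" v] cell_values_swap
  by (simp add: cell_values_def triangle_energy_def)

section \<open>Self-similarity and monotonicity of the graph energies\<close>

context gasket
begin

text \<open>Two cells share at most one point, so both ends of a common edge would coincide.\<close>

lemma edges_disjoint:
  assumes "i \<noteq> j"
  shows "map_prod (sg_map q i) (sg_map q i) ` edges q m \<inter> map_prod (sg_map q j) (sg_map q j) ` edges q m = {}"
proof (rule ccontr)
  assume "\<not> ?thesis"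
  then obtain x y x' y' where e: "adj q m x y" "adj q m x' y'"
      and eq: "sg_map q i x = sg_map q j x'" "sg_map q i y = sg_map q j y'"
    by (auto simp: edges_def)
  then have "x \<in> triangle" "x' \<in> triangle" "y \<in> triangle" "y' \<in> triangle"
    using adj_vertices vertices_subset_triangle by blast+
  then have "x = q j" "y = q j" using cells_meet_at_corner[OF _ _ assms] eq by auto
  then show False using e by (simp add: adj_def)
qed

lemma level_energy_Suc:
  "level_energy q (Suc m) u = 5 / 3 * (\<Sum>i\<in>UNIV. level_energy q m (u \<circ> sg_map q i))"
proof -
  have "(\<Sum>(x, y)\<in>edges q (Suc m). (u x - u y)\<^sup>2)
      = (\<Sum>i\<in>UNIV. \<Sum>(x, y)\<in>map_prod (sg_map q i) (sg_map q i) ` edges q m. (u x - u y)\<^sup>2)"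
    unfolding edges_Suc using edges_disjoint finite_edges
    by (intro sum.UNION_disjoint) auto
  also have "\<dots> = (\<Sum>i\<in>UNIV. \<Sum>(x, y)\<in>edges q m. ((u \<circ> sg_map q i) x - (u \<circ> sg_map q i) y)\<^sup>2)"
  proof (rule sum.cong[OF refl])
    fix i
    have "inj_on (map_prod (sg_map q i) (sg_map q i)) (edges q m)"
      using inj_sg_map by (meson inj_on_subset prod.inj_map subset_UNIV)
    then show "(\<Sum>(x, y)\<in>map_prod (sg_map q i) (sg_map q i) ` edges q m. (u x - u y)\<^sup>2) =
        (\<Sum>(x, y)\<in>edges q m. ((u \<circ> sg_map q i) x - (u \<circ> sg_map q i) y)\<^sup>2)"
      by (simp add: sum.reindex case_prod_unfold)
  qed
  finally show ?thesis
    unfolding level_energy_edges sum_distrib_left[symmetric] sum_divide_distrib[symmetric] by simp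
qed

lemma level_energy_0: "level_energy q 0 u = triangle_energy (u \<circ> q)"
proof -
  have "(\<Sum>y | y \<in> range q \<and> adj q 0 x y. (u x - u y)\<^sup>2) = (\<Sum>y\<in>range q. (u x - u y)\<^sup>2)"
    if "x \<in> range q" for x
    using that by (intro sum.mono_neutral_left) (auto simp: adj_0)
  then have "level_energy q 0 u = (\<Sum>x\<in>range q. \<Sum>y\<in>range q. (u x - u y)\<^sup>2) / 2"
    by (simp add: level_energy_def)
  also have "\<dots> = (\<Sum>i\<in>UNIV. \<Sum>j\<in>UNIV. (u (q i) - u (q j))\<^sup>2) / 2"
    by (simp add: sum.reindex[OF inj_corners])
  also have "\<dots> = triangle_energy (u \<circ> q)"
    by (simp add: sum_3 triangle_energy_def power2_commute)
  finally show ?thesis .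
qed

text \<open>For one triangle the deviation term of \<open>refined_triangle_energy\<close> is
  nonnegative; self-similarity carries this to every level.\<close>

lemma level_energy_mono_Suc: "level_energy q m u \<le> level_energy q (Suc m) u"
proof (induction m arbitrary: u)
  case 0
  have "level_energy q (Suc 0) u = 5 / 3 * (\<Sum>i\<in>UNIV. triangle_energy (\<lambda>j. u (sg_map q i (q j))))"
    by (simp add: level_energy_Suc level_energy_0 o_def)
  also have "\<dots> = triangle_energy (u \<circ> q) +
      5 / 3 * (\<Sum>i\<in>UNIV. triangle_energy (\<lambda>j. u (sg_map q i (q j)) - cell_values i (u \<circ> q) j))"
    by (intro refined_triangle_energy) (simp_all add: sg_map_fixes sg_map_swap)
  also have "\<dots> \<ge> triangle_energy (u \<circ> q)"
    by (simp add: triangle_energy_def sum_nonneg)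
  finally show ?case unfolding level_energy_0 .
next
  case (Suc m)
  then show ?case
    unfolding level_energy_Suc by (intro mult_left_mono sum_mono) auto
qed

lemma energy_eq_SUP: "energy q u = (SUP m. ereal (level_energy q m u))"
proof -
  have "incseq (\<lambda>m. ereal (level_energy q m u))"
    by (intro incseq_SucI) (simp add: level_energy_mono_Suc)
  then show ?thesis
    unfolding energy_def by (intro limI LIMSEQ_SUP)
qed

lemma level_energy_le_energy: "ereal (level_energy q m u) \<le> energy q u"
  unfolding energy_eq_SUP by (rule SUP_upper) simp

lemma energy_eq_level_energy:
  assumes "\<And>n. m \<le> n \<Longrightarrow> level_energy q n u = level_energy q m u"
  shows "energy q u = ereal (level_energy q m u)"
proof (rule antisym)
  have mono: "mono (\<lambda>m. level_energy q m u)"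
    by (intro incseq_SucI level_energy_mono_Suc)
  have "level_energy q n u \<le> level_energy q m u" for n
    using assms[of "max m n"] monoD[OF mono, of n "max m n"] by simp
  then show "energy q u \<le> ereal (level_energy q m u)"
    unfolding energy_eq_SUP by (intro SUP_least) simp
qed (rule level_energy_le_energy)

section \<open>Gluing functions on cells, and harmonic functions as uniform limits\<close>

lemma continuous_on_sg_inv: "continuous_on S (sg_inv q i)"
  unfolding sg_inv_def by (intro continuous_intros)

text \<open>The choice of a cell is ambiguous only at points common to two cells, that is at
  \<open>sg_map q i (q j) = sg_map q j (q i)\<close>. There it does not matter once
  \<open>u i (q j) = u j (q i)\<close>.\<close>

definition glue :: "(3 \<Rightarrow> real ^ 2 \<Rightarrow> real) \<Rightarrow> real ^ 2 \<Rightarrow> real" where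
  "glue u x = (let i = (SOME i. x \<in> sg_map q i ` SG q) in u i (sg_inv q i x))"

lemma glue_sg_map:
  assumes compat: "\<And>i j. u i (q j) = u j (q i)" and x: "x \<in> SG q"
  shows "glue u (sg_map q i x) = u i x"
proof -
  define j where "j = (SOME j. sg_map q i x \<in> sg_map q j ` SG q)"
  have "sg_map q i x \<in> sg_map q j ` SG q"
    unfolding j_def using x by (intro someI[of "\<lambda>j. sg_map q i x \<in> sg_map q j ` SG q" i]) auto
  then obtain y where y: "y \<in> SG q" "sg_map q i x = sg_map q j y" by blast
  have "glue u (sg_map q i x) = u j y"
    unfolding glue_def Let_def j_def[symmetric] by (simp add: y(2))
  also have "\<dots> = u i x"
  proof (cases "i = j")
    case True
    then show ?thesis using y(2) inj_sg_map[of q i] by (auto dest: injD)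
  next
    case False
    have "x \<in> triangle" "y \<in> triangle" using x y SG_subset_triangle by auto
    then have "x = q j" "y = q i"
      using cells_meet_at_corner[of x y i j] cells_meet_at_corner[of y x j i] False y(2) by auto
    then show ?thesis using compat by simp
  qed
  finally show ?thesis .
qed

lemma continuous_on_glue:
  assumes compat: "\<And>i j. u i (q j) = u j (q i)" and cont: "\<And>i. continuous_on (SG q) (u i)"
  shows "continuous_on (SG q) (glue u)"
proof -
  have "continuous_on (sg_map q i ` SG q) (glue u)" for i
  proof -
    have "continuous_on (sg_map q i ` SG q) (\<lambda>x. u i (sg_inv q i x))"
      by (rule continuous_on_compose2[OF cont])
         (auto simp: continuous_on_sg_inv)
    moreover have "continuous_on (sg_map q i ` SG q) (glue u) \<longleftrightarrow>
        continuous_on (sg_map q i ` SG q) (\<lambda>x. u i (sg_inv q i x))"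
      by (intro continuous_on_cong refl) (auto simp: glue_sg_map[where u=u, OF compat])
    ultimately show ?thesis by simp
  qed
  moreover have "closed (sg_map q i ` SG q)" for i
    by (intro compact_imp_closed compact_continuous_image continuous_on_sg_map compact_SG)
  ultimately have "continuous_on (\<Union>i. sg_map q i ` SG q) (glue u)"
    by (intro continuous_on_closed_Union) auto
  then show ?thesis using SG_self_similar by simp
qed

text \<open>The function that is affine on each level-\<open>n\<close> cell and takes the values of
  the 1/5--2/5 rule at the vertices of level \<open>n\<close>.\<close>

primrec approx :: "nat \<Rightarrow> (3 \<Rightarrow> real) \<Rightarrow> real ^ 2 \<Rightarrow> real" where
  "approx 0 v = (\<lambda>x. \<Sum>j\<in>UNIV. bary j x * v j)"
| "approx (Suc n) v = glue (\<lambda>i. approx n (cell_values i v))"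

lemma approx_corner: "approx n v (q j) = v j"
proof (induction n arbitrary: v j)
  case 0
  have "(\<Sum>k\<in>UNIV. bary k (q j) * v k) = (\<Sum>k\<in>UNIV. if j = k then v k else 0)"
    by (intro sum.cong refl) (simp add: bary_corner)
  then show ?case by simp
next
  case (Suc n)
  have "approx (Suc n) v (sg_map q j (q j)) = approx n (cell_values j v) (q j)"
    unfolding approx.simps
    by (rule glue_sg_map) (auto simp: Suc corner_SG intro: cell_values_swap)
  then show ?case by (simp add: sg_map_fixes Suc cell_values_def)
qed

lemma approx_sg_map:
  "x \<in> SG q \<Longrightarrow> approx (Suc n) v (sg_map q i x) = approx n (cell_values i v) x"
  unfolding approx.simps by (rule glue_sg_map) (auto simp: approx_corner intro: cell_values_swap)

lemma continuous_on_approx: "continuous_on (SG q) (approx n v)"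
proof (induction n arbitrary: v)
  case 0
  show ?case by (auto intro!: continuous_intros continuous_on_bary)
next
  case (Suc n)
  show ?case unfolding approx.simps
    by (intro continuous_on_glue Suc) (auto simp: approx_corner intro: cell_values_swap)
qed

lemma bary_average:
  assumes x: "x \<in> triangle" and d: "\<And>j. \<bar>v j - t\<bar> \<le> d"
  shows "\<bar>(\<Sum>j\<in>UNIV. bary j x * v j) - t\<bar> \<le> d"
proof -
  have "(\<Sum>j\<in>UNIV. bary j x * v j) - t = (\<Sum>j\<in>UNIV. bary j x * (v j - t))"
    by (simp add: right_diff_distrib sum_subtractf sum_bary flip: sum_distrib_right)
  also have "\<bar>\<dots>\<bar> \<le> (\<Sum>j\<in>UNIV. bary j x * d)"
  proof (intro order_trans[OF sum_abs] sum_mono)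
    fix j
    show "\<bar>bary j x * (v j - t)\<bar> \<le> bary j x * d"
      using d[of j] bary_nonneg[OF x, of j] by (simp add: abs_mult mult_left_mono)
  qed
  also have "\<dots> = d" by (simp add: sum_bary flip: sum_distrib_right)
  finally show ?thesis .
qed

text \<open>At the first level both functions are compared with the common corner value
  \<open>v i\<close>, from which they differ by at most \<open>3 / 5 * d\<close> and
  \<open>d\<close>. Each further level passes to a cell, where the oscillation has shrunk by
  3/5.\<close>

lemma approx_diff:
  assumes "x \<in> SG q" "\<And>j k. \<bar>v j - v k\<bar> \<le> d"
  shows "\<bar>approx (Suc n) v x - approx n v x\<bar> \<le> 2 * d * (3 / 5) ^ n"
  using assms
proof (induction n arbitrary: x v d)
  case 0
  obtain i y where y: "y \<in> SG q" "x = sg_map q i y" using 0(1) SG_self_similar by blast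
  have tri: "x \<in> triangle" "y \<in> triangle" using 0(1) y SG_subset_triangle by auto
  have d: "d \<ge> 0" using 0(2)[of 1 1] by simp
  have "\<bar>approx 0 (cell_values i v) y - v i\<bar> \<le> 3 / 5 * d"
    unfolding approx.simps
    using cell_values_contract[of v d i _ i] 0(2)
    by (intro bary_average tri) (simp add: cell_values_def[of i v i])
  moreover have "\<bar>approx 0 v x - v i\<bar> \<le> d"
    unfolding approx.simps using 0(2) by (intro bary_average tri)
  moreover have "approx (Suc 0) v x = approx 0 (cell_values i v) y"
    unfolding y(2) by (rule approx_sg_map[OF y(1)])
  ultimately show ?case using d unfolding abs_le_iff by simp
next
  case (Suc n)
  obtain i y where y: "y \<in> SG q" "x = sg_map q i y" using Suc(2) SG_self_similar by blast
  have "\<bar>approx (Suc n) (cell_values i v) y - approx n (cell_values i v) y\<bar>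
      \<le> 2 * (3 / 5 * d) * (3 / 5) ^ n"
    using Suc(3) by (intro Suc.IH y cell_values_contract)
  then show ?case
    unfolding y(2) approx_sg_map[OF y(1)] by simp
qed

definition harmonic :: "(3 \<Rightarrow> real) \<Rightarrow> real ^ 2 \<Rightarrow> real" where
  "harmonic v x = lim (\<lambda>n. approx n v x)"

lemma approx_uniform_limit: "uniform_limit (SG q) (\<lambda>n. approx n v) (harmonic v) sequentially"
proof -
  \<comment> \<open>A crude bound on the oscillation of \<open>v\<close>: the sum of all
    differences.\<close>
  define d where "d = (\<Sum>j\<in>UNIV. \<Sum>k\<in>UNIV. \<bar>v j - v k\<bar>)"
  have d: "\<bar>v j - v k\<bar> \<le> d" for j k
  proof -
    have "\<bar>v j - v k\<bar> \<le> (\<Sum>k\<in>UNIV. \<bar>v j - v k\<bar>)" by (intro member_le_sum) auto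
    also have "\<dots> \<le> d" unfolding d_def by (intro member_le_sum[of j]) (auto intro: sum_nonneg)
    finally show ?thesis .
  qed
  \<comment> \<open>The limit as a telescoping series, to which the Weierstrass test
    applies.\<close>
  define r where "r x = approx 0 v x + (\<Sum>i. approx (Suc i) v x - approx i v x)" for x
  have "uniform_limit (SG q) (\<lambda>n x. \<Sum>i<n. approx (Suc i) v x - approx i v x)
      (\<lambda>x. \<Sum>i. approx (Suc i) v x - approx i v x) sequentially"
  proof (rule Weierstrass_m_test)
    show "norm (approx (Suc n) v x - approx n v x) \<le> 2 * d * (3 / 5) ^ n" if "x \<in> SG q" for n x
      using approx_diff[OF that d] by simp
    show "summable (\<lambda>n. 2 * d * (3 / 5) ^ n)"
      by (intro summable_mult summable_geometric) simp
  qed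
  then have "uniform_limit (SG q) (\<lambda>n x. approx 0 v x + (\<Sum>i<n. approx (Suc i) v x - approx i v x))
      r sequentially"
    unfolding r_def by (intro uniform_limit_add uniform_limit_const)
  moreover have "approx 0 v x + (\<Sum>i<n. approx (Suc i) v x - approx i v x) = approx n v x" for n x
    using sum_lessThan_telescope[of "\<lambda>i. approx i v x" n] by simp
  ultimately have lim: "uniform_limit (SG q) (\<lambda>n. approx n v) r sequentially"
    by simp
  have "harmonic v x = r x" if "x \<in> SG q" for x
    unfolding harmonic_def by (rule limI[OF tendsto_uniform_limitI[OF lim that]])
  then show ?thesis
    using lim by (subst uniform_limit_cong'[where g = "\<lambda>n. approx n v" and i = r]) auto
qed

lemma continuous_on_harmonic: "continuous_on (SG q) (harmonic v)"
  by (rule uniform_limit_theorem[OF _ approx_uniform_limit]) (auto simp: continuous_on_approx)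

lemma harmonic_corner: "harmonic v (q j) = v j"
  unfolding harmonic_def by (intro limI) (simp add: approx_corner)

lemma harmonic_sg_map:
  assumes "x \<in> SG q"
  shows "harmonic v (sg_map q i x) = harmonic (cell_values i v) x"
proof -
  have "(\<lambda>n. approx (Suc n) v (sg_map q i x)) \<longlonglongrightarrow> harmonic v (sg_map q i x)"
    using tendsto_uniform_limitI[OF approx_uniform_limit sg_map_SG[OF assms]] by (rule LIMSEQ_Suc)
  moreover have "(\<lambda>n. approx (Suc n) v (sg_map q i x)) \<longlonglongrightarrow> harmonic (cell_values i v) x"
    unfolding approx_sg_map[OF assms] by (rule tendsto_uniform_limitI[OF approx_uniform_limit assms])
  ultimately show ?thesis by (rule LIMSEQ_unique)
qed

lemma level_energy_harmonic: "level_energy q n (harmonic v) = triangle_energy v"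
proof (induction n arbitrary: v)
  case 0
  show ?case by (simp add: level_energy_0 o_def harmonic_corner)
next
  case (Suc n)
  have "level_energy q n (harmonic v \<circ> sg_map q i) = level_energy q n (harmonic (cell_values i v))" for i
    using vertices_subset_SG[THEN subsetD] by (intro level_energy_cong) (auto simp: harmonic_sg_map)
  then show ?case
    by (simp only: level_energy_Suc Suc triangle_energy_cell_values)
qed

text \<open>Harmonic functions glued along the cells of level \<open>m\<close> continue any values
  on \<open>vertices q m\<close> without further energy. This reduces minimization over the gasket
  to the finite graph.\<close>

lemma harmonic_extension:
  obtains u where "continuous_on (SG q) u" "\<And>x. x \<in> vertices q m \<Longrightarrow> u x = g x"
    "\<And>n. m \<le> n \<Longrightarrow> level_energy q n u = level_energy q m u"
proof -
  have "\<exists>u. continuous_on (SG q) u \<and> (\<forall>x\<in>vertices q m. u x = g x) \<and>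
      (\<forall>n\<ge>m. level_energy q n u = level_energy q m u)"
  proof (induction m arbitrary: g)
    case 0
    show ?case
      by (intro exI[of _ "harmonic (g \<circ> q)"])
         (auto simp: continuous_on_harmonic harmonic_corner level_energy_harmonic)
  next
    case (Suc m)
    have "\<forall>i. \<exists>u. continuous_on (SG q) u \<and> (\<forall>x\<in>vertices q m. u x = g (sg_map q i x)) \<and>
        (\<forall>n\<ge>m. level_energy q n u = level_energy q m u)"
      using Suc.IH[of "\<lambda>x. g (sg_map q _ x)"] by blast
    then obtain u where cont: "\<And>i. continuous_on (SG q) (u i)"
      and val: "\<And>i x. x \<in> vertices q m \<Longrightarrow> u i x = g (sg_map q i x)"
      and en: "\<And>i n. m \<le> n \<Longrightarrow> level_energy q n (u i) = level_energy q m (u i)"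
      by metis
    \<comment> \<open>Both sides are the value of \<open>g\<close> at the common point of the two
      cells.\<close>
    have compat: "u i (q j) = u j (q i)" for i j
      by (simp add: val corner_in_vertices sg_map_swap)
    note glue = glue_sg_map[where u=u, OF compat]
    have le: "level_energy q n (glue u \<circ> sg_map q i) = level_energy q n (u i)" for n i
      using vertices_subset_SG[THEN subsetD] by (intro level_energy_cong) (auto simp: glue)
    have "level_energy q n (glue u) = level_energy q (Suc m) (glue u)" if n: "Suc m \<le> n" for n
    proof -
      obtain k where k: "n = Suc k" "m \<le> k" using n by (cases n) auto
      show ?thesis
        unfolding k(1) level_energy_Suc le by (simp only: en[OF k(2)])
    qed
    moreover have "glue u x = g x" if "x \<in> vertices q (Suc m)" for x
    proof -
      from that obtain i y where "y \<in> vertices q m" "x = sg_map q i y" by auto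
      then show ?thesis using glue[of y i] vertices_subset_SG[of m] val by auto
    qed
    ultimately show ?case
      using continuous_on_glue[where u=u, OF compat cont] by blast
  qed
  then show ?thesis using that by blast
qed

end

subsection \<open>Conductances\<close>

definition graph_conductance :: "(3 \<Rightarrow> real ^ 2) \<Rightarrow> nat \<Rightarrow> real ^ 2 \<Rightarrow> real ^ 2 \<Rightarrow> real" where
  "graph_conductance q m x y = (if adj q m x y then (5 / 3) ^ m else 0)"

lemma network_graph_conductance: "network (vertices q m) (graph_conductance q m)"
  unfolding network_def graph_conductance_def
  by (auto simp: finite_vertices dest: adj_sym adj_vertices) (simp add: adj_def)

lemma dirichlet_graph_conductance:
  "dirichlet (vertices q m) (graph_conductance q m) u = level_energy q m u"
proof -
  have "(\<Sum>y\<in>vertices q m. graph_conductance q m x y * (u x - u y)\<^sup>2)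
      = (5 / 3) ^ m * (\<Sum>y | y \<in> vertices q m \<and> adj q m x y. (u x - u y)\<^sup>2)" for x
  proof -
    have "(\<Sum>y | y \<in> vertices q m \<and> adj q m x y. (u x - u y)\<^sup>2)
        = (\<Sum>y\<in>vertices q m. if adj q m x y then (u x - u y)\<^sup>2 else 0)"
      by (rule sum.inter_filter[OF finite_vertices])
    then show ?thesis
      by (auto simp: graph_conductance_def sum_distrib_left intro!: sum.cong)
  qed
  then show ?thesis
    by (simp add: dirichlet_def level_energy_def sum_distrib_left)
qed

lemma finite_neighbours: "finite {y. adj q m x y}"
  by (rule finite_subset[OF _ finite_vertices[of q m]]) (auto dest: adj_vertices)

text \<open>The loop between two visits to \<open>z\<close> is cut out; the endpoints remain and no
  new vertex appears.\<close>

lemma shorter_avoiding_path: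
  assumes p: "avoiding_path q m A x y p" and "\<not> distinct p"
  obtains p' where "avoiding_path q m A x y p'" "length p' < length p"
proof -
  obtain r s t z where d: "p = r @ [z] @ s @ [z] @ t"
    using not_distinct_decomp[OF assms(2)] by blast
  have "successively (adj q m) (r @ [z] @ t)"
    using p unfolding avoiding_path_def d successively_append_iff by auto
  moreover have "hd (r @ [z] @ t) = hd p" "last (r @ [z] @ t) = last p" "set (r @ [z] @ t) \<subseteq> set p"
    by (auto simp: d hd_append)
  ultimately have "avoiding_path q m A x y (r @ [z] @ t)"
    using p unfolding avoiding_path_def by auto
  moreover have "length (r @ [z] @ t) < length p" by (simp add: d)
  ultimately show ?thesis using that by blast
qed

text \<open>Extended naturals are well-ordered, so the infimum is a minimum, and a shortest path has
  no repeated vertex. Its \<open>N\<close> edges mean \<open>Suc N\<close> list entries.\<close>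

lemma avoiding_dist_attained:
  assumes "avoiding_dist q m A x y = enat N"
  obtains p where "avoiding_path q m A x y p" "distinct p" "length p = Suc N"
proof -
  define S where "S = (\<lambda>p. enat (length p - 1)) ` {p. avoiding_path q m A x y p}"
  have inf: "Inf S = enat N" using assms by (simp add: avoiding_dist_def S_def)
  \<comment> \<open>An empty set would have infinite infimum.\<close>
  then have "S \<noteq> {}" by (auto simp: Inf_enat_def)
  then have "Inf S \<in> S" unfolding Inf_enat_def by (auto intro: LeastI)
  then obtain p where p: "avoiding_path q m A x y p" "length p - 1 = N"
    unfolding inf by (auto simp: S_def)
  have min: "N \<le> length p' - 1" if "avoiding_path q m A x y p'" for p'
  proof -
    have "Inf S \<le> enat (length p' - 1)"
      using that by (intro Inf_lower) (auto simp: S_def)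
    then show ?thesis by (simp add: inf)
  qed
  have ne: "p' \<noteq> []" if "avoiding_path q m A x y p'" for p'
    using that by (simp add: avoiding_path_def)
  have "distinct p"
  proof (rule ccontr)
    assume "\<not> distinct p"
    then obtain p' where "avoiding_path q m A x y p'" "length p' < length p"
      using shorter_avoiding_path[OF p(1)] by blast
    \<comment> \<open>Nonempty lists keep the subtraction in \<open>length p' - 1\<close> from being
      truncated.\<close>
    then show False using min[of p'] ne[of p'] p(2) by (cases p') auto
  qed
  then show ?thesis using that p ne[OF p(1)] by (cases p) auto
qed

lemma path_weight_graph_conductance:
  assumes "successively (adj q m) p"
  shows "path_weight (graph_conductance q m) (6 * (5 / 3) ^ m) p = (1 / 6) ^ (length p - 1)"
  using assms
proof (induction p rule: induct_list012)
  case (3 x y p)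
  then show ?case by (simp add: graph_conductance_def)
qed auto

section \<open>Bounded degrees and the lower bound for conductances\<close>

context gasket
begin

text \<open>A corner \<open>q j\<close> lies only in cell \<open>j\<close> of the first level, as
  the image of itself, so refining never adds neighbours to the two at level 0.\<close>

lemma card_neighbours_corner: "card {y. adj q m (q j) y} \<le> 2"
proof (induction m)
  case 0
  have "{y. adj q 0 (q j) y} = q ` (UNIV - {j})"
    using inj_corners by (auto simp: adj_0 inj_eq)
  also have "card \<dots> \<le> card (UNIV - {j})" by (rule card_image_le) simp
  also have "\<dots> = 2" by (simp add: card_Diff_singleton)
  finally show ?case .
next
  case (Suc m)
  have "{y. adj q (Suc m) (q j) y} \<subseteq> sg_map q j ` {y. adj q m (q j) y}"
  proof
    fix y assume "y \<in> {y. adj q (Suc m) (q j) y}"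
    then obtain i x' y' where *: "q j = sg_map q i x'" "y = sg_map q i y'" "adj q m x' y'"
      by (auto simp: adj_Suc)
    then have x': "x' \<in> triangle"
      using adj_vertices vertices_subset_triangle by blast
    have eq: "sg_map q j (q j) = sg_map q i x'" unfolding sg_map_fixes by (rule *(1))
    have "i = j"
    proof (rule ccontr)
      assume "i \<noteq> j"
      then have "q j = q i"
        using cells_meet_at_corner[OF triangle_corner x' _ eq] by simp
      then show False using \<open>i \<noteq> j\<close> inj_corners by (auto dest: injD)
    qed
    moreover from this have "x' = q j" using eq inj_sg_map[of q j] by (auto dest: injD)
    ultimately show "y \<in> sg_map q j ` {y. adj q m (q j) y}" using * by simp
  qed
  then have "card {y. adj q (Suc m) (q j) y} \<le> card (sg_map q j ` {y. adj q m (q j) y})"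
    by (intro card_mono finite_imageI finite_neighbours)
  also have "\<dots> \<le> card {y. adj q m (q j) y}" by (intro card_image_le finite_neighbours)
  finally show ?case using Suc by simp
qed

text \<open>A vertex lying in two cells of the first level is a corner of both of them.\<close>

lemma card_neighbours: "card {y. adj q m x y} \<le> 6"
proof (induction m arbitrary: x)
  case 0
  have "{y. adj q 0 x y} \<subseteq> range q" by (auto simp: adj_0)
  then have "card {y. adj q 0 x y} \<le> card (range q)" by (intro card_mono) auto
  also have "\<dots> \<le> card (UNIV :: 3 set)" by (rule card_image_le) simp
  finally show ?case by simp
next
  case (Suc m)
  \<comment> \<open>Since \<open>sg_inv\<close> is total, \<open>S i\<close> is empty when the
    preimage of \<open>x\<close> is not a vertex of level \<open>m\<close>.\<close>
  define S where "S i = {y. adj q m (sg_inv q i x) y}" for i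
  have S: "{y. adj q (Suc m) x y} = (\<Union>i. sg_map q i ` S i)"
  proof -
    have "x = sg_map q i x' \<longleftrightarrow> x' = sg_inv q i x" for i x' by auto
    then show ?thesis by (auto simp: adj_Suc S_def)
  qed
  have le: "card (sg_map q i ` S i) \<le> card (S i)" for i
    by (simp add: S_def card_image_le finite_neighbours)
  show ?case
  \<comment> \<open>Either three cells contribute at most two neighbours each, or some
    \<open>S i\<close> has more. Then the preimage in cell \<open>i\<close> is no corner, so no
    other cell contributes and the induction hypothesis bounds \<open>S i\<close>.\<close>
  proof (cases "\<forall>i. card (S i) \<le> 2")
    case True
    have "card (\<Union>i. sg_map q i ` S i) \<le> (\<Sum>i\<in>UNIV. card (sg_map q i ` S i))"
      by (intro card_UN_le) simp
    also have "\<dots> \<le> (\<Sum>i\<in>(UNIV :: 3 set). 2)"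
      using True le by (intro sum_mono) (meson order_trans)
    finally show ?thesis by (simp add: S)
  next
    case False
    then obtain i where i: "card (S i) > 2" by (auto simp: not_le)
    have tri: "sg_inv q j x \<in> triangle" if "S j \<noteq> {}" for j
      using that adj_vertices vertices_subset_triangle by (fastforce simp: S_def)
    have "S j = {}" if "j \<noteq> i" for j
    proof (rule ccontr)
      assume "S j \<noteq> {}"
      moreover have "S i \<noteq> {}" using i by auto
      ultimately have "sg_inv q i x = q j"
        using that by (intro cells_meet_at_corner[of _ "sg_inv q j x" i j] tri) auto
      then show False using i card_neighbours_corner[of m j] by (simp add: S_def)
    qed
    then have "sg_map q j ` S j \<subseteq> sg_map q i ` S i" for j
      by (cases "j = i") auto
    then have "(\<Union>i. sg_map q i ` S i) = sg_map q i ` S i" by blast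
    then show ?thesis
      using le[of i] Suc[of "sg_inv q i x"] by (simp add: S) (simp add: S_def)
  qed
qed

lemma row_sum_graph_conductance:
  "(\<Sum>y\<in>vertices q m. graph_conductance q m x y) \<le> 6 * (5 / 3) ^ m"
proof -
  have "(\<Sum>y\<in>vertices q m. graph_conductance q m x y) = (\<Sum>y | adj q m x y. (5 / 3) ^ m)"
    unfolding graph_conductance_def
    by (rule sum.mono_neutral_cong_right) (auto simp: finite_vertices dest: adj_vertices)
  also have "\<dots> = real (card {y. adj q m x y}) * (5 / 3) ^ m" by simp
  also have "\<dots> \<le> 6 * (5 / 3) ^ m"
    using card_neighbours[of m x] by (intro mult_right_mono) auto
  finally show ?thesis .
qed

text \<open>The hypotheses say that \<open>c\<close> is the trace on \<open>A\<close> of the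
  level-\<open>m\<close> energy. Harmonic extension lifts optimal values on
  \<open>vertices q m\<close> to a minimizer with the same energy, and
  \<open>dirichlet_determines\<close> together with the zero convention makes the coefficients
  unique.\<close>

lemma conductance_eq:
  assumes A: "A \<subseteq> vertices q m" and net: "network A c"
    and le: "\<And>u. dirichlet A c u \<le> level_energy q m u"
    and ex: "\<And>f. \<exists>u. (\<forall>x\<in>A. u x = f x) \<and> level_energy q m u = dirichlet A c f"
  shows "conductance q A = c"
proof -
  have finA: "finite A" using net by (simp add: network_def)
  have minimizer: "\<exists>u. energy_minimizer q A f u \<and> energy q u = ereal (dirichlet A c f)" for f
  proof -
    obtain g where g: "\<forall>x\<in>A. g x = f x" "level_energy q m g = dirichlet A c f"
      using ex by blast
    obtain u where u: "continuous_on (SG q) u" "\<And>x. x \<in> vertices q m \<Longrightarrow> u x = g x"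
        "\<And>n. m \<le> n \<Longrightarrow> level_energy q n u = level_energy q m u"
      using harmonic_extension[of m g] by blast
    have en: "energy q u = ereal (dirichlet A c f)"
      using energy_eq_level_energy[OF u(3)] level_energy_cong[of q m u g] u(2) g(2) by simp
    have "energy q u \<le> energy q v" if "\<forall>x\<in>A. v x = f x" for v
    proof -
      have "dirichlet A c f = dirichlet A c v" using that by (intro dirichlet_cong) simp
      also have "ereal \<dots> \<le> ereal (level_energy q m v)" using le by simp
      also have "\<dots> \<le> energy q v" by (rule level_energy_le_energy)
      finally show ?thesis using en by simp
    qed
    moreover have "\<forall>x\<in>A. u x = f x" using u(2) g(1) A by auto
    ultimately have "energy_minimizer q A f u"
      using u(1) en by (simp add: energy_minimizer_def energy_dom_def)
    then show ?thesis using en by blast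
  qed
  \<comment> \<open>Minimizers for the same data have equal energy, so the constructed one fixes the
    value.\<close>
  have min_energy: "energy q u = ereal (dirichlet A c f)" if "energy_minimizer q A f u" for f u
  proof -
    obtain w where w: "energy_minimizer q A f w" "energy q w = ereal (dirichlet A c f)"
      using minimizer by blast
    have "energy q u = energy q w"
      using that w(1) unfolding energy_minimizer_def by (intro antisym) blast+
    then show ?thesis using w(2) by simp
  qed
  have agree: "dirichlet A d u = dirichlet A d f" if "energy_minimizer q A f u" for d f u
    using that by (intro dirichlet_cong) (simp add: energy_minimizer_def)
  show ?thesis
    unfolding conductance_def
  proof (rule the_equality)
    show "is_conductance q A c"
      unfolding is_conductance_def
      using net min_energy agree[where d = c] by (auto simp: network_def dirichlet_def)
  next
    fix d assume d: "is_conductance q A d"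
    have "dirichlet A d f = dirichlet A c f" for f
    proof -
      obtain u where u: "energy_minimizer q A f u" "energy q u = ereal (dirichlet A c f)"
        using minimizer by blast
      have "energy q u = ereal (dirichlet A d u)"
        using d u(1) unfolding is_conductance_def dirichlet_def by blast
      then show ?thesis using u agree[OF u(1), of d] by simp
    qed
    then have "d x y = c x y" if "x \<in> A" "y \<in> A" "x \<noteq> y" for x y
      using dirichlet_determines[of A d c x y] that finA d net
      by (simp add: is_conductance_def network_def)
    moreover have "d x y = c x y" if "x \<notin> A \<or> y \<notin> A \<or> x = y" for x y
      using that d net by (simp add: is_conductance_def network_def)
    ultimately show "d = c" by blast
  qed
qed

lemma conductance_lower_bound:
  assumes A: "A \<subseteq> vertices q m" and xy: "x \<in> A" "y \<in> A" "x \<noteq> y"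
    and dist: "avoiding_dist q m A x y = enat N"
  shows "(1 / 6) ^ N * (5 / 3) ^ m \<le> conductance q A x y"
proof -
  \<comment> \<open>At most six edges meet at a vertex, each of conductance
    \<open>(5 / 3) ^ m\<close>.\<close>
  let ?c = "graph_conductance q m" and ?M = "6 * (5 / 3) ^ m :: real"
  have V: "A \<union> (vertices q m - A) = vertices q m" using A by blast
  obtain c where net: "network A c"
    and le: "\<And>u. dirichlet A c u \<le> level_energy q m u"
    and ex: "\<And>f. \<exists>u. (\<forall>x\<in>A. u x = f x) \<and> level_energy q m u = dirichlet A c f"
    and cr: "\<And>p. crossing A (vertices q m) p \<Longrightarrow> path_weight ?c ?M p \<le> c (hd p) (last p) / ?M"
    using network_trace[of "vertices q m - A" A ?c ?M] network_graph_conductance[of q m]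
      row_sum_graph_conductance finite_vertices[of q m]
    unfolding V dirichlet_graph_conductance by auto
  obtain p where p: "avoiding_path q m A x y p" "distinct p" "length p = Suc N"
    using avoiding_dist_attained[OF dist] .
  have "crossing A (vertices q m) p"
    using p(1,2) xy by (auto simp: crossing_def avoiding_path_def)
  then have "(1 / 6) ^ N \<le> c x y / ?M"
    using cr[of p] path_weight_graph_conductance[of q m p] p(1,3) by (simp add: avoiding_path_def)
  \<comment> \<open>Clearing the denominator leaves a spare factor 6, which is then dropped.\<close>
  then have "6 * ((1 / 6) ^ N * (5 / 3) ^ m) \<le> c x y"
    by (simp add: field_simps)
  moreover have "0 \<le> (1 / 6 :: real) ^ N * (5 / 3) ^ m" by simp
  ultimately show ?thesis
    unfolding conductance_eq[OF A net le ex] by linarith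
qed

end

theorem theorem2p3:
  fixes q :: "3 \<Rightarrow> real ^ 2"
  assumes "equilateral q"
  shows "\<exists>a :: nat \<Rightarrow> real. (\<forall>N. a N > 0) \<and>
    (\<forall>(m :: nat) (A :: (real ^ 2) set) x y (N :: nat).
       A \<subseteq> vertices q m \<longrightarrow> x \<in> A \<longrightarrow> y \<in> A \<longrightarrow> x \<noteq> y \<longrightarrow> avoiding_dist q m A x y = enat N \<longrightarrow>
       a N * (5 / 3) ^ m \<le> conductance q A x y)"
proof -
  interpret gasket q by standard (rule assms)
  show ?thesis
    using conductance_lower_bound by (intro exI[of _ "\<lambda>N. (1 / 6) ^ N"]) simp
qed

end
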